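(* The skew-symmetric matrix $\theta=(\theta_{\alpha\beta})_{1\le\alpha,\beta\le5}$, whose entries are the Kähler forms of the complex structures $J_{\alpha\beta}=\mathcal I_\alpha\mathcal I_\beta$ on $\mathbb{R}^8\cong\mathbb{H}^2$, allows to construct both the left quaternionic $4$-form $\Omega_L$ and the right Kähler $2$-forms $\omega_{R_i},\omega_{R_j},\omega_{R_k}$ as $$\Omega_L=-\frac12\tau_2(\theta)$$ and $$\omega_{R_i}=\theta_{34},\qquad \omega_{R_j}=-\theta_{24},\qquad \omega_{R_k}=\theta_{23}.$$
   Context: $\mathbb{R}^8=\mathbb{H}^2$ with Euclidean metric and real coordinates from the basis $1,i,j,k$ of each copy of $\mathbb{H}$. For $u\in\{i,j,k\}$, $R_u$ and $L_u$ denote right multiplication $x\mapsto xu$ and left multiplication $x\mapsto ux$ on $\mathbb{H}$, and also the corresponding diagonal actions on $\mathbb{H}^2$. The five involutions are (in block form on $\mathbb{H}\oplus\mathbb{H}$) $\mathcal I_1=\begin{pmatrix}0&\mathrm{Id}\\ \mathrm{Id}&0\end{pmatrix}$, $\mathcal I_2,\mathcal I_3,\mathcal I_4=\begin{pmatrix}0&-R_u\\ R_u&0\end{pmatrix}$ for $u=i,j,k$ respectively, $\mathcal I_5=\begin{pmatrix}\mathrm{Id}&0\\0&-\mathrm{Id}\end{pmatrix}$. The Kähler form of an orthogonal complex structure $J$ is $\omega_J(X,Y)=\langle X,JY\rangle$; $\theta_{\alpha\beta}=\omega_{J_{\alpha\beta}}$ for $\alpha\ne\beta$ and $\theta_{\alpha\alpha}=0$.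 $\tau_2(\theta)$ is the coefficient of $t^3$ in $\det(tI-\theta)$, computed in the commutative algebra of even forms. $\omega_{R_u},\omega_{L_u}$ are the Kähler forms of the diagonal actions on $\mathbb{H}^2$, and $\Omega_L=\omega_{L_i}^2+\omega_{L_j}^2+\omega_{L_k}^2$ (wedge squares). *)

theory Defs
  imports "HOL-Analysis.Analysis" "HOL-Computational_Algebra.Polynomial"
begin

section \<open>The exterior algebra of forms\<close>

text \<open>
  A form of mixed degree on \<open>V\<close> is a function on lists of vectors; its restriction to lists of
  length \<open>k\<close> is the component of degree \<open>k\<close>. On a Euclidean space the components of degree
  above the dimension vanish, so these functions are exactly the elements of the finite direct sum
  of the spaces of alternating \<open>k\<close>-forms.
\<close>

definition alternating_form :: "('v::real_vector list \<Rightarrow> real) \<Rightarrow> bool" where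
  "alternating_form f \<longleftrightarrow>
     (\<forall>xs ys. linear (\<lambda>v. f (xs @ v # ys))) \<and> (\<forall>vs. \<not> distinct vs \<longrightarrow> f vs = 0)"

definition even_degree :: "('v list \<Rightarrow> real) \<Rightarrow> bool" where
  "even_degree f \<longleftrightarrow> (\<forall>vs. odd (length vs) \<longrightarrow> f vs = 0)"

text \<open>
  The sign of the shuffle that lists the positions in \<open>S\<close> first, followed by the remaining ones.
\<close>

definition shuffle_sign :: "nat set \<Rightarrow> real" where
  "shuffle_sign S = (- 1) ^ card {(i, j). i < j \<and> i \<notin> S \<and> j \<in> S}"

text \<open>
  The wedge product is normalised as a sum over shuffles, so that
  \<open>(\<alpha> \<and> \<beta>) (v, w) = \<alpha> v * \<beta> w - \<alpha> w * \<beta> v\<close> for 1-forms.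
\<close>

definition wedge ::
  "('v list \<Rightarrow> real) \<Rightarrow> ('v list \<Rightarrow> real) \<Rightarrow> 'v list \<Rightarrow> real" where
  "wedge f g vs =
     (\<Sum>S\<in>Pow {..<length vs}. shuffle_sign S * f (nths vs S) * g (nths vs (- S)))"

definition contract :: "'v \<Rightarrow> ('v list \<Rightarrow> real) \<Rightarrow> 'v list \<Rightarrow> real" where
  "contract v f = (\<lambda>vs. f (v # vs))"

definition grade :: "('v list \<Rightarrow> real) \<Rightarrow> 'v list \<Rightarrow> real" where
  "grade f = (\<lambda>vs. (- 1) ^ length vs * f vs)"

lemma wedge_Nil [simp]: "wedge f g [] = f [] * g []"
  by (simp add: wedge_def shuffle_sign_def)

lemma shuffle_sign_insert_0:
  "shuffle_sign (insert 0 (Suc ` T)) = shuffle_sign T"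
proof -
  have "{(i, j). i < j \<and> i \<notin> insert 0 (Suc ` T) \<and> j \<in> insert 0 (Suc ` T)}
      = map_prod Suc Suc ` {(i, j). i < j \<and> i \<notin> T \<and> j \<in> T}" (is "?A = ?B")
  proof (intro equalityI subsetI)
    fix p assume "p \<in> ?A"
    then obtain i j where p: "p = (i, j)" "i < j" "i \<notin> insert 0 (Suc ` T)"
      "j \<in> insert 0 (Suc ` T)" by auto
    then obtain i' j' where "i = Suc i'" "j = Suc j'" "j' \<in> T"
      by (cases i) auto
    with p show "p \<in> ?B" by (auto intro!: image_eqI[where x = "(i', j')"])
  qed auto
  then show ?thesis
    by (simp add: shuffle_sign_def card_image map_prod_inj_on[of Suc UNIV Suc UNIV, simplified]
        inj_on_subset[OF map_prod_inj_on[of Suc UNIV Suc UNIV, simplified]])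
qed

lemma shuffle_sign_Suc:
  assumes "finite T"
  shows "shuffle_sign (Suc ` T) = (- 1) ^ card T * shuffle_sign T"
proof -
  let ?I = "{(i, j). i < j \<and> i \<notin> T \<and> j \<in> T}"
  have eq: "{(i, j). i < j \<and> i \<notin> Suc ` T \<and> j \<in> Suc ` T}
      = map_prod Suc Suc ` ?I \<union> Pair 0 ` Suc ` T" (is "?A = ?B")
  proof (intro equalityI subsetI)
    fix p assume "p \<in> ?A"
    then obtain i j' where p: "p = (i, Suc j')" "i < Suc j'" "i \<notin> Suc ` T" "j' \<in> T"
      by auto
    show "p \<in> ?B"
      using p by (cases i) (auto intro!: image_eqI[where x = "(i - 1, j')"])
  qed auto
  have "?I \<subseteq> (\<Union>j\<in>T. {..<j}) \<times> T" by auto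
  then have fin: "finite ?I"
    by (rule finite_subset) (use assms in auto)
  have "card (map_prod Suc Suc ` ?I \<union> Pair 0 ` Suc ` T)
      = card (map_prod Suc Suc ` ?I) + card (Pair (0::nat) ` Suc ` T)"
    by (rule card_Un_disjoint) (use fin assms in auto)
  also have "card (map_prod Suc Suc ` ?I) = card ?I"
    by (rule card_image) (auto simp: inj_on_def)
  also have "card (Pair (0::nat) ` Suc ` T) = card T"
    by (simp add: card_image inj_on_def)
  finally show ?thesis
    by (simp add: shuffle_sign_def eq power_add)
qed

lemma wedge_Cons:
  "wedge f g (v # vs) = wedge (contract v f) g vs + wedge (grade f) (contract v g) vs"
proof -
  let ?h = "\<lambda>S. shuffle_sign S * f (nths (v # vs) S) * g (nths (v # vs) (- S))"
  let ?P = "Pow {..<length vs}"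
  have P: "Pow {..<length (v # vs)} = image Suc ` ?P \<union> insert 0 ` image Suc ` ?P"
    by (simp add: lessThan_Suc_eq_insert_0 Pow_insert image_Pow_surj)
  have "wedge f g (v # vs) = sum ?h (image Suc ` ?P) + sum ?h (insert 0 ` image Suc ` ?P)"
    unfolding wedge_def P by (rule sum.union_disjoint) auto
  also have "sum ?h (image Suc ` ?P) = (\<Sum>T\<in>?P. ?h (Suc ` T))"
    by (rule sum.reindex[unfolded o_def]) (auto simp: inj_on_def inj_image_eq_iff)
  also have "\<dots> = wedge (grade f) (contract v g) vs"
    unfolding wedge_def
  proof (rule sum.cong[OF refl])
    fix T assume T: "T \<in> ?P"
    then have fin: "finite T" by (auto intro: finite_subset)
    have "{i. i < length vs \<and> i \<in> T} = T" using T by auto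
    then have "length (nths vs T) = card T" by (simp add: length_nths)
    then show "?h (Suc ` T)
        = shuffle_sign T * grade f (nths vs T) * contract v g (nths vs (- T))"
      by (simp add: shuffle_sign_Suc[OF fin] nths_Cons grade_def contract_def image_iff
          Collect_neg_eq)
  qed
  also have "sum ?h (insert 0 ` image Suc ` ?P) = (\<Sum>T\<in>?P. ?h (insert 0 (Suc ` T)))"
  proof -
    have "inj_on (\<lambda>T. insert 0 (Suc ` T)) ?P"
    proof (rule inj_onI)
      fix A B :: "nat set"
      assume "insert 0 (Suc ` A) = insert 0 (Suc ` B)"
      then have "Suc ` A = Suc ` B"
        by (metis Diff_insert_absorb image_iff nat.distinct(1))
      then show "A = B" by (simp add: inj_image_eq_iff)
    qed
    then show ?thesis
      by (simp add: image_image sum.reindex)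
  qed
  also have "\<dots> = wedge (contract v f) g vs"
    unfolding wedge_def
    by (rule sum.cong[OF refl])
      (simp add: shuffle_sign_insert_0 nths_Cons contract_def image_iff Collect_neg_eq)
  finally show ?thesis by simp
qed

lemma contract_simps [simp]:
  "contract v (\<lambda>vs. f vs + g vs) = (\<lambda>vs. contract v f vs + contract v g vs)"
  "contract v (\<lambda>vs. c * f vs) = (\<lambda>vs. c * contract v f vs)"
  "contract v (wedge f g) =
    (\<lambda>vs. wedge (contract v f) g vs + wedge (grade f) (contract v g) vs)"
  "contract v (\<lambda>vs. - f vs) = (\<lambda>vs. - contract v f vs)"
  "contract v (grade f) = (\<lambda>vs. - grade (contract v f) vs)"
  by (auto simp: contract_def grade_def wedge_Cons fun_eq_iff)

lemma grade_simps [simp]: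
  "grade (\<lambda>vs. f vs + g vs) = (\<lambda>vs. grade f vs + grade g vs)"
  "grade (\<lambda>vs. c * f vs) = (\<lambda>vs. c * grade f vs)"
  "grade (\<lambda>vs. - f vs) = (\<lambda>vs. - grade f vs)"
  "grade (grade f) = f"
  by (auto simp: grade_def fun_eq_iff algebra_simps simp flip: power_add mult.assoc)

lemma wedge_add_left: "wedge (\<lambda>vs. f vs + f' vs) g vs = wedge f g vs + wedge f' g vs"
  by (simp add: wedge_def algebra_simps sum.distrib)

lemma wedge_add_right: "wedge f (\<lambda>vs. g vs + g' vs) vs = wedge f g vs + wedge f g' vs"
  by (simp add: wedge_def algebra_simps sum.distrib)

lemma wedge_scale_left: "wedge (\<lambda>vs. c * f vs) g vs = c * wedge f g vs"
  by (simp add: wedge_def algebra_simps sum_distrib_left)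

lemma wedge_scale_right: "wedge f (\<lambda>vs. c * g vs) vs = c * wedge f g vs"
  by (simp add: wedge_def algebra_simps sum_distrib_left)

lemma wedge_minus_left: "wedge (\<lambda>vs. - f vs) g vs = - wedge f g vs"
  using wedge_scale_left[of "- 1"] by simp

lemma wedge_minus_right: "wedge f (\<lambda>vs. - g vs) vs = - wedge f g vs"
  using wedge_scale_right[of _ "- 1"] by simp

lemmas wedge_linear =
  wedge_add_left wedge_add_right wedge_scale_left wedge_scale_right
  wedge_minus_left wedge_minus_right

lemma wedge_zero [simp]: "wedge (\<lambda>_. 0) g vs = 0" "wedge f (\<lambda>_. 0) vs = 0"
  by (simp_all add: wedge_def)

lemma grade_wedge [simp]: "grade (wedge f g) = wedge (grade f) (grade g)"
proof
  fix vs show "grade (wedge f g) vs = wedge (grade f) (grade g) vs"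
  proof (induction vs arbitrary: f g)
    case (Cons v vs)
    have "grade (wedge f g) (v # vs) = - grade (contract v (wedge f g)) vs"
      by (simp add: grade_def contract_def del: contract_simps)
    then show ?case
      by (simp add: Cons wedge_Cons wedge_linear)
  qed (simp add: grade_def)
qed

lemma wedge_assoc: "wedge (wedge f g) h vs = wedge f (wedge g h) vs"
  by (induction vs arbitrary: f g h) (simp_all add: wedge_Cons wedge_linear)

lemma wedge_commute_aux:
  "(grade f = f \<longrightarrow> wedge f g vs = wedge g f vs) \<and>
   (grade f = (\<lambda>vs. - f vs) \<longrightarrow> wedge f g vs = wedge (grade g) f vs)"
proof (induction vs arbitrary: f g)
  case Nil
  show ?case by (simp add: grade_def)
next
  case (Cons v vs)
  show ?case
  proof (intro conjI impI)
    assume ev: "grade f = f"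
    have "contract v (grade f) = contract v f" by (simp only: ev)
    then have odd: "grade (contract v f) = (\<lambda>vs. - contract v f vs)"
      by (simp add: fun_eq_iff minus_equation_iff eq_commute)
    have "wedge (contract v f) g vs = wedge (grade g) (contract v f) vs"
      using Cons odd by blast
    moreover have "wedge f (contract v g) vs = wedge (contract v g) f vs"
      using Cons ev by blast
    ultimately show "wedge f g (v # vs) = wedge g f (v # vs)"
      by (simp add: wedge_Cons ev)
  next
    assume od: "grade f = (\<lambda>vs. - f vs)"
    have "contract v (grade f) = (\<lambda>vs. - contract v f vs)"
      unfolding od by (simp only: contract_simps)
    then have "grade (contract v f) = contract v f"
      by (simp add: fun_eq_iff)
    then have "wedge (contract v f) g vs = wedge g (contract v f) vs"
      using Cons by blast
    moreover have "wedge f (contract v g) vs = wedge (grade (contract v g)) f vs"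
      using Cons od by blast
    ultimately show "wedge f g (v # vs) = wedge (grade g) f (v # vs)"
      by (simp add: wedge_Cons wedge_linear od)
  qed
qed

lemma even_degree_iff_grade: "even_degree f \<longleftrightarrow> grade f = f"
proof -
  have "(- 1) ^ n * x = x \<longleftrightarrow> (odd n \<longrightarrow> x = 0)" for n and x :: real
    by (cases "even n") auto
  then show ?thesis
    by (simp add: even_degree_def grade_def fun_eq_iff)
qed

lemma wedge_commute: "even_degree f \<Longrightarrow> wedge f g vs = wedge g f vs"
  using wedge_commute_aux even_degree_iff_grade by blast

lemma even_degree_wedge: "even_degree f \<Longrightarrow> even_degree g \<Longrightarrow> even_degree (wedge f g)"
  by (simp add: even_degree_iff_grade)

definition multilinear :: "('v::real_vector list \<Rightarrow> real) \<Rightarrow> bool" where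
  "multilinear f \<longleftrightarrow> (\<forall>xs ys. linear (\<lambda>v. f (xs @ v # ys)))"

definition adjacent_alternating :: "('v list \<Rightarrow> real) \<Rightarrow> bool" where
  "adjacent_alternating f \<longleftrightarrow> (\<forall>xs v ys. f (xs @ v # v # ys) = 0)"

lemma alternating_form_iff:
  "alternating_form f \<longleftrightarrow> multilinear f \<and> adjacent_alternating f"
proof
  assume "alternating_form f"
  then show "multilinear f \<and> adjacent_alternating f"
    by (simp add: alternating_form_def multilinear_def adjacent_alternating_def)
next
  assume asm: "multilinear f \<and> adjacent_alternating f"
  have lin: "linear (\<lambda>v. f (xs @ v # ys))" for xs ys
    using asm by (simp add: multilinear_def)
  have adj: "f (xs @ v # v # ys) = 0" for xs v ys
    using asm by (simp add: adjacent_alternating_def)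
  have swap: "f (xs @ a # b # ys) = - f (xs @ b # a # ys)" for xs a b ys
  proof -
    have 1: "f (xs @ (a + b) # c # ys) = f (xs @ a # c # ys) + f (xs @ b # c # ys)" for c
      using linear_add[OF lin[of xs "c # ys"]] .
    have 2: "f (xs @ c # (a + b) # ys) = f (xs @ c # a # ys) + f (xs @ c # b # ys)" for c
      using linear_add[OF lin[of "xs @ [c]" ys], of a b] by simp
    have "f (xs @ (a + b) # (a + b) # ys)
        = f (xs @ a # a # ys) + f (xs @ a # b # ys) + (f (xs @ b # a # ys) + f (xs @ b # b # ys))"
      by (simp only: 1 2)
    then show ?thesis by (simp add: adj)
  qed
  have rep: "f (xs @ a # ms @ a # ys) = 0" for xs a ms ys
  proof (induction ms arbitrary: xs)
    case (Cons m ms)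
    show ?case using Cons[of "xs @ [m]"] swap[of xs a m "ms @ a # ys"] by simp
  qed (simp add: adj)
  have "f vs = 0" if "\<not> distinct vs" for vs
    using not_distinct_decomp[OF that] rep by auto
  with lin show "alternating_form f" by (simp add: alternating_form_def)
qed

lemma multilinear_contract: "multilinear f \<Longrightarrow> multilinear (contract v f)"
  by (simp add: multilinear_def contract_def flip: append_Cons)

lemma multilinear_grade: "multilinear f \<Longrightarrow> multilinear (grade f)"
  unfolding multilinear_def grade_def
  by (simp add: linear_iff algebra_simps)

lemma multilinear_contract_arg:
  assumes "multilinear f"
  shows "contract (v + w) f = (\<lambda>vs. contract v f vs + contract w f vs)"
    and "contract (c *\<^sub>R v) f = (\<lambda>vs. c * contract v f vs)"
proof -
  have "linear (\<lambda>v. f ([] @ v # ys))" for ys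
    using assms unfolding multilinear_def by blast
  then show "contract (v + w) f = (\<lambda>vs. contract v f vs + contract w f vs)"
    and "contract (c *\<^sub>R v) f = (\<lambda>vs. c * contract v f vs)"
    by (auto simp: contract_def linear_iff)
qed

lemma multilinear_wedge:
  assumes "multilinear f" "multilinear g"
  shows "multilinear (wedge f g)"
proof -
  have "linear (\<lambda>v. wedge f g (xs @ v # ys))" for xs ys
    using assms
  proof (induction xs arbitrary: f g)
    case Nil
    then show ?case
      by (intro linearI)
        (simp_all add: wedge_Cons multilinear_contract_arg wedge_linear algebra_simps)
  next
    case (Cons x xs)
    show ?case
      unfolding append_Cons wedge_Cons
      by (intro linear_compose_add Cons.IH multilinear_contract multilinear_grade Cons.prems)
  qed
  then show ?thesis by (simp add: multilinear_def)
qed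

lemma adjacent_alternating_contract:
  "adjacent_alternating f \<Longrightarrow> adjacent_alternating (contract v f)"
  by (simp add: adjacent_alternating_def contract_def flip: append_Cons)

lemma adjacent_alternating_grade: "adjacent_alternating f \<Longrightarrow> adjacent_alternating (grade f)"
  by (simp add: adjacent_alternating_def grade_def)

lemma adjacent_alternating_contract_twice:
  assumes "adjacent_alternating f"
  shows "contract v (contract v f) = (\<lambda>_. 0)"
proof -
  have "f ([] @ v # v # ys) = 0" for ys
    using assms unfolding adjacent_alternating_def by blast
  then show ?thesis by (simp add: contract_def)
qed

lemma adjacent_alternating_wedge:
  assumes "adjacent_alternating f" "adjacent_alternating g"
  shows "adjacent_alternating (wedge f g)"
proof -
  have "wedge f g (xs @ v # v # ys) = 0" for xs v ys
    using assms
  proof (induction xs arbitrary: f g)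
    case Nil
    then show ?case
      by (simp add: wedge_Cons adjacent_alternating_contract_twice wedge_linear)
  next
    case (Cons x xs)
    then show ?case
      by (simp add: wedge_Cons adjacent_alternating_contract adjacent_alternating_grade)
  qed
  then show ?thesis by (simp add: adjacent_alternating_def)
qed

lemma alternating_form_wedge:
  "alternating_form f \<Longrightarrow> alternating_form g \<Longrightarrow> alternating_form (wedge f g)"
  by (simp add: alternating_form_iff multilinear_wedge adjacent_alternating_wedge)

section \<open>The commutative algebra of even forms\<close>

typedef (overloaded) 'v even_form =
  "{f :: 'v::euclidean_space list \<Rightarrow> real. alternating_form f \<and> even_degree f}"
  morphisms apply_form Abs_even_form
  by (rule exI[of _ "\<lambda>_. 0"])
    (simp add: alternating_form_def even_degree_def linear_iff)

setup_lifting type_definition_even_form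

instantiation even_form :: (euclidean_space) comm_ring_1
begin

lift_definition zero_even_form :: "'a even_form" is "\<lambda>_. 0"
  by (simp add: alternating_form_def even_degree_def linear_iff)

lift_definition one_even_form :: "'a even_form" is "\<lambda>vs. if vs = [] then 1 else 0"
  by (auto simp: alternating_form_def even_degree_def linear_iff)

lift_definition plus_even_form :: "'a even_form \<Rightarrow> 'a even_form \<Rightarrow> 'a even_form"
  is "\<lambda>f g vs. f vs + g vs"
  by (auto simp: alternating_form_def even_degree_def intro: linear_compose_add)

lift_definition minus_even_form :: "'a even_form \<Rightarrow> 'a even_form \<Rightarrow> 'a even_form"
  is "\<lambda>f g vs. f vs - g vs"
  by (auto simp: alternating_form_def even_degree_def intro: linear_compose_sub)

lift_definition uminus_even_form :: "'a even_form \<Rightarrow> 'a even_form"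
  is "\<lambda>f vs. - f vs"
  by (auto simp: alternating_form_def even_degree_def intro: linear_compose_neg)

lift_definition times_even_form :: "'a even_form \<Rightarrow> 'a even_form \<Rightarrow> 'a even_form" is wedge
  by (simp add: alternating_form_wedge even_degree_wedge)

lemma wedge_one_left: "wedge (\<lambda>vs. if vs = [] then 1 else 0) f vs = f vs"
proof (induction vs arbitrary: f)
  case (Cons v vs)
  have "contract v (\<lambda>vs. if vs = [] then 1 else 0) = (\<lambda>_. 0)"
    by (simp add: contract_def)
  moreover have "grade (\<lambda>vs::'b list. if vs = [] then 1 else 0) = (\<lambda>vs. if vs = [] then 1 else 0)"
    by (simp add: grade_def fun_eq_iff)
  ultimately show ?case using Cons by (simp add: wedge_Cons contract_def)
qed simp

instance
proof
  fix a b c :: "'a even_form"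
  show "a + b + c = a + (b + c)" "a + b = b + a" "0 + a = a" "- a + a = 0" "a - b = a + - b"
    by (transfer; simp add: fun_eq_iff)+
  show "a * b * c = a * (b * c)"
    by transfer (simp add: fun_eq_iff wedge_assoc)
  show "a * b = b * a"
    by transfer (simp add: fun_eq_iff wedge_commute)
  show "(a + b) * c = a * c + b * c"
    by transfer (simp add: fun_eq_iff wedge_add_left)
  show "1 * a = a"
    by transfer (simp add: fun_eq_iff wedge_one_left)
  show "(0::'a even_form) \<noteq> 1"
    by transfer (auto simp: fun_eq_iff)
qed

end

instantiation even_form :: (euclidean_space) real_algebra_1
begin

lift_definition scaleR_even_form :: "real \<Rightarrow> 'a even_form \<Rightarrow> 'a even_form"
  is "\<lambda>c f vs. c * f vs"
  by (auto simp: alternating_form_def even_degree_def linear_iff algebra_simps)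

instance
proof
  fix a b :: real and x y :: "'a even_form"
  show "a *\<^sub>R (x + y) = a *\<^sub>R x + a *\<^sub>R y" "(a + b) *\<^sub>R x = a *\<^sub>R x + b *\<^sub>R x"
    "a *\<^sub>R b *\<^sub>R x = (a * b) *\<^sub>R x" "1 *\<^sub>R x = x"
    by (transfer; simp add: fun_eq_iff algebra_simps)+
  show "a *\<^sub>R x * y = a *\<^sub>R (x * y)" "x * a *\<^sub>R y = a *\<^sub>R (x * y)"
    by (transfer; simp add: fun_eq_iff wedge_linear)+
qed

end

section \<open>Kaehler forms and the characteristic coefficient\<close>

definition orthogonal_complex_structure :: "('v::euclidean_space \<Rightarrow> 'v) \<Rightarrow> bool" where
  "orthogonal_complex_structure J \<longleftrightarrow> orthogonal_transformation J \<and> (\<forall>x. J (J x) = - x)"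

lemma orthogonal_complex_structure_skew:
  assumes "orthogonal_complex_structure J"
  shows "x \<bullet> J y = - (y \<bullet> J x)"
proof -
  have "J x \<bullet> J (J y) = x \<bullet> J y" "J (J y) = - y"
    using assms unfolding orthogonal_complex_structure_def orthogonal_transformation_def by blast+
  then have "x \<bullet> J y = J x \<bullet> (- y)" by metis
  then show ?thesis by (simp add: inner_commute)
qed

text \<open>
  The conditional only makes the function total: without it the right-hand side need not be
  alternating.
\<close>

lift_definition kaehler_form :: "('v::euclidean_space \<Rightarrow> 'v) \<Rightarrow> 'v even_form" is
  "\<lambda>J vs. if orthogonal_complex_structure J
          then (case vs of [x, y] \<Rightarrow> x \<bullet> J y | _ \<Rightarrow> 0) else 0"
proof -
  fix J :: "'v \<Rightarrow> 'v"
  let ?f = "\<lambda>vs. if orthogonal_complex_structure J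
          then (case vs of [x, y] \<Rightarrow> x \<bullet> J y | _ \<Rightarrow> 0) else 0"
  show "alternating_form ?f \<and> even_degree ?f"
  proof (cases "orthogonal_complex_structure J")
    case True
    then have J: "linear J"
      by (simp add: orthogonal_complex_structure_def orthogonal_transformation_def)
    have self: "x \<bullet> J x = 0" for x
      using orthogonal_complex_structure_skew[OF True, of x x] by simp
    have "linear (\<lambda>v. ?f (xs @ v # ys))" for xs ys
      using linear_add[OF J] linear_scale[OF J]
      by (auto simp: True linear_iff inner_add_left inner_add_right split: list.split
          simp: append_eq_Cons_conv Cons_eq_append_conv)
    moreover have "?f vs = 0" if "\<not> distinct vs" for vs
      using that self by (auto split: list.split)
    ultimately show ?thesis
      by (auto simp: alternating_form_def even_degree_def split: list.split)
  next
    case False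
    then show ?thesis by (simp add: alternating_form_def even_degree_def linear_iff)
  qed
qed

lemma kaehler_form_apply:
  "orthogonal_complex_structure J \<Longrightarrow> apply_form (kaehler_form J) [x, y] = x \<bullet> J y"
  by transfer simp

text \<open>
  The index type \<open>5\<close> has the five elements \<open>1, 2, 3, 4, 5\<close> (with \<open>5 = 0\<close>); \<open>mat [:0, 1:]\<close> is
  the polynomial matrix \<open>t I\<close>.
\<close>

definition tau2 :: "'a::comm_ring_1 ^ 5 ^ 5 \<Rightarrow> 'a" where
  "tau2 A = coeff (det (mat [:0, 1:] - (\<chi> a b. [:A $ a $ b:]))) 3"

section \<open>Quaternions and the five involutions\<close>

text \<open>\<open>(a, b, c, d)\<close> stands for \<open>a + b i + c j + d k\<close>.\<close>

type_synonym quat = "real \<times> real \<times> real \<times> real"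

fun qmult :: "quat \<Rightarrow> quat \<Rightarrow> quat" where
  "qmult (a, b, c, d) (a', b', c', d') =
     (a * a' - b * b' - c * c' - d * d',
      a * b' + b * a' + c * d' - d * c',
      a * c' - b * d' + c * a' + d * b',
      a * d' + b * c' - c * b' + d * a')"

definition q_i :: quat where "q_i = (0, 1, 0, 0)"
definition q_j :: quat where "q_j = (0, 0, 1, 0)"
definition q_k :: quat where "q_k = (0, 0, 0, 1)"

definition Rmul :: "quat \<Rightarrow> quat \<Rightarrow> quat" where "Rmul u x = qmult x u"
definition Lmul :: "quat \<Rightarrow> quat \<Rightarrow> quat" where "Lmul u x = qmult u x"

definition Rdiag :: "quat \<Rightarrow> quat \<times> quat \<Rightarrow> quat \<times> quat" where
  "Rdiag u = map_prod (Rmul u) (Rmul u)"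
definition Ldiag :: "quat \<Rightarrow> quat \<times> quat \<Rightarrow> quat \<times> quat" where
  "Ldiag u = map_prod (Lmul u) (Lmul u)"

definition block ::
  "(quat \<Rightarrow> quat) \<Rightarrow> (quat \<Rightarrow> quat) \<Rightarrow> (quat \<Rightarrow> quat) \<Rightarrow> (quat \<Rightarrow> quat)
    \<Rightarrow> quat \<times> quat \<Rightarrow> quat \<times> quat" where
  "block A B C D = (\<lambda>(x, y). (A x + B y, C x + D y))"

definition involution :: "5 \<Rightarrow> quat \<times> quat \<Rightarrow> quat \<times> quat" where
  "involution a =
    (if a = 1 then block (\<lambda>_. 0) id id (\<lambda>_. 0)
     else if a = 2 then block (\<lambda>_. 0) (\<lambda>y. - Rmul q_i y) (Rmul q_i) (\<lambda>_. 0)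
     else if a = 3 then block (\<lambda>_. 0) (\<lambda>y. - Rmul q_j y) (Rmul q_j) (\<lambda>_. 0)
     else if a = 4 then block (\<lambda>_. 0) (\<lambda>y. - Rmul q_k y) (Rmul q_k) (\<lambda>_. 0)
     else block id (\<lambda>_. 0) (\<lambda>_. 0) (\<lambda>y. - y))"

definition J_struct :: "5 \<Rightarrow> 5 \<Rightarrow> quat \<times> quat \<Rightarrow> quat \<times> quat" where
  "J_struct a b = involution a \<circ> involution b"

definition theta :: "(quat \<times> quat) even_form ^ 5 ^ 5" where
  "theta = (\<chi> a b. if a = b then 0 else kaehler_form (J_struct a b))"

definition omega_R :: "quat \<Rightarrow> (quat \<times> quat) even_form" where
  "omega_R u = kaehler_form (Rdiag u)"

definition omega_L :: "quat \<Rightarrow> (quat \<times> quat) even_form" where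
  "omega_L u = kaehler_form (Ldiag u)"

definition Omega_L :: "(quat \<times> quat) even_form" where
  "Omega_L = omega_L q_i ^ 2 + omega_L q_j ^ 2 + omega_L q_k ^ 2"

text \<open>
  All maps to which \<^const>\<open>kaehler_form\<close> is applied above are orthogonal complex structures.
\<close>

lemmas q_defs = q_i_def q_j_def q_k_def

lemma qmult_linear:
  "qmult (x + y) u = qmult x u + qmult y u" "qmult u (x + y) = qmult u x + qmult u y"
  "qmult (c *\<^sub>R x) u = c *\<^sub>R qmult x u" "qmult u (c *\<^sub>R x) = c *\<^sub>R qmult u x"
  "qmult (- x) u = - qmult x u" "qmult u (- x) = - qmult u x"
  by (cases x; cases y; cases u; simp add: algebra_simps)+

lemma qmult_unit:
  assumes "u \<in> {q_i, q_j, q_k}"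
  shows "qmult (qmult x u) u = - x" "qmult u (qmult u x) = - x"
    and "qmult x u \<bullet> qmult y u = x \<bullet> y" "qmult u x \<bullet> qmult u y = x \<bullet> y"
  using assms by (cases x; cases y; elim insertE emptyE; simp add: q_defs)+

lemma orthogonal_complex_structure_Rdiag_Ldiag:
  assumes "u \<in> {q_i, q_j, q_k}"
  shows "orthogonal_complex_structure (Rdiag u)" "orthogonal_complex_structure (Ldiag u)"
  by (simp_all add: orthogonal_complex_structure_def orthogonal_transformation_def linear_iff
      Rdiag_def Ldiag_def Rmul_def Lmul_def split_paired_all qmult_linear qmult_unit[OF assms]
      del: qmult.simps)

lemma exhaust_5:
  fixes a :: 5
  shows "a = 1 \<or> a = 2 \<or> a = 3 \<or> a = 4 \<or> a = 5"
proof (induct a)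
  case (of_int z)
  then have "0 \<le> z" and "z < 5" by simp_all
  then have "z = 0 \<or> z = 1 \<or> z = 2 \<or> z = 3 \<or> z = 4" by arith
  then show ?case by auto
qed

lemma involution_simps:
  "involution 1 (x, y) = (y, x)"
  "involution 2 (x, y) = (- qmult y q_i, qmult x q_i)"
  "involution 3 (x, y) = (- qmult y q_j, qmult x q_j)"
  "involution 4 (x, y) = (- qmult y q_k, qmult x q_k)"
  "involution 5 (x, y) = (x, - y)"
  by (simp_all add: involution_def block_def Rmul_def)

lemma involution_orthogonal:
  "orthogonal_transformation (involution a)" "involution a (involution a x) = x"
  using exhaust_5[of a]
  by (cases x; elim disjE; simp add: orthogonal_transformation_def linear_iff split_paired_all
      involution_simps qmult_linear qmult_unit del: qmult.simps)+

lemma qmult_anticommute: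
  "qmult (qmult x q_j) q_i = - qmult (qmult x q_i) q_j"
  "qmult (qmult x q_k) q_i = - qmult (qmult x q_i) q_k"
  "qmult (qmult x q_k) q_j = - qmult (qmult x q_j) q_k"
  by (cases x; simp add: q_defs)+

lemma involution_anticommute:
  assumes "a \<noteq> b"
  shows "involution a (involution b x) = - involution b (involution a x)"
proof -
  obtain y z where x: "x = (y, z)" by (cases x)
  show ?thesis
    unfolding x
    using exhaust_5[of a] exhaust_5[of b]
    using assms by (elim disjE) (simp_all only: involution_simps qmult_linear qmult_anticommute
        uminus_Pair minus_minus not_True_eq_False simp_thms)
qed

lemma orthogonal_complex_structure_J:
  assumes "a \<noteq> b"
  shows "orthogonal_complex_structure (J_struct a b)"
proof -
  have "linear (involution a)" for a
    using involution_orthogonal(1) by (simp add: orthogonal_transformation_def)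
  then show ?thesis
    unfolding orthogonal_complex_structure_def J_struct_def
    by (simp add: orthogonal_transformation_compose involution_orthogonal
        involution_anticommute[OF assms] linear_neg)
qed

lemma J_struct_swap: "a \<noteq> b \<Longrightarrow> J_struct b a x = - J_struct a b x"
  by (simp add: J_struct_def involution_anticommute[of a b])

lemma theta_skew: "transpose theta = - theta"
proof -
  have skew: "kaehler_form (J_struct b a) = - kaehler_form (J_struct a b)" if "a \<noteq> b" for a b
  proof -
    have "J_struct b a = (\<lambda>x. - J_struct a b x)"
      using J_struct_swap[OF that] by (rule ext)
    moreover have "kaehler_form (\<lambda>x. - J x) = - kaehler_form J"
      if "orthogonal_complex_structure J" "orthogonal_complex_structure (\<lambda>x. - J x)"
      for J :: "quat \<times> quat \<Rightarrow> quat \<times> quat"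
      using that by transfer (auto simp: fun_eq_iff split: list.split)
    ultimately show ?thesis
      using orthogonal_complex_structure_J[OF that] orthogonal_complex_structure_J[OF that[symmetric]]
      by simp
  qed
  have "transpose theta $ a $ b = (- theta) $ a $ b" for a b
    by (cases "a = b") (simp_all add: transpose_def theta_def skew[of a b])
  then show ?thesis by (simp add: vec_eq_iff)
qed

end

theory Submission
  imports Defs
begin

text \<open>
  Among the terms of the Leibniz expansion of \<open>det (t I - \<theta>)\<close>, whose diagonal entries
  are all \<open>t\<close>, exactly those of transpositions contribute to \<open>t\<^sup>3\<close>. Hence
  \<open>\<tau>\<^sub>2(\<theta>)\<close> is the sum of \<open>\<theta>\<^sub>a\<^sub>b\<^sup>2\<close> over pairs. A Fierz identity for quaternions turns the
  quadrilinear function \<open>\<Sum> \<theta>\<^sub>a\<^sub>b(x, y) \<theta>\<^sub>a\<^sub>b(z, w)\<close> into the sum of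
  \<open>\<langle>u x, z\<rangle>\<langle>u y, w\<rangle> - \<langle>u y, z\<rangle>\<langle>u x, w\<rangle>\<close> over \<open>u = 1, i, j, k\<close>. Under antisymmetrisation
  the term of \<open>u = 1\<close> vanishes and the others give the squares of the \<open>\<omega>\<close> of left multiplication.
\<close>

section \<open>The coefficient of a determinant belonging to transpositions\<close>

text \<open>An asymmetric total relation holds exactly one ordered pair for each two-element set, so
  \<open>P\<close> lists every transposition once. The outer minus is the sign of a transposition;
  the minus signs of its two entries cancel.\<close>

lemma coeff_det_transpositions:
  fixes A :: "'a::comm_ring_1 ^ 'n ^ 'n" and P :: "'n rel"
  assumes diag: "\<And>i. A $ i $ i = 0" and P: "asym P" "total P" and n: "CARD('n) = n + 2"
  shows "coeff (det (mat [:0, 1:] - (\<chi> a b. [:A $ a $ b:]))) n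
    = - (\<Sum>(a, b)\<in>P. A $ a $ b * A $ b $ a)"
proof -
  let ?M = "mat [:0, 1:] - (\<chi> a b. [:A $ a $ b:])"
  \<comment> \<open>As \<open>A\<close> vanishes on the diagonal, each fixed point of
    \<open>p\<close> contributes a factor t and each moved point a constant.\<close>
  have prod: "(\<Prod>i\<in>UNIV. ?M $ i $ p i)
     = monom (\<Prod>i | p i \<noteq> i. - A $ i $ p i) (card {i. p i = i})" for p
  proof -
    have "(\<Prod>i\<in>UNIV. ?M $ i $ p i) = (\<Prod>i\<in>{i. p i = i} \<union> {i. p i \<noteq> i}. ?M $ i $ p i)"
      by (rule prod.cong) auto
    also have "\<dots> = (\<Prod>i | p i = i. ?M $ i $ p i) * (\<Prod>i | p i \<noteq> i. ?M $ i $ p i)"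
      by (rule prod.union_disjoint) auto
    also have "(\<Prod>i | p i = i. ?M $ i $ p i) = (\<Prod>i | p i = i. monom 1 1)"
      by (rule prod.cong) (use diag in \<open>auto simp: mat_def monom_altdef\<close>)
    also have "\<dots> = monom 1 (card {i. p i = i})"
      by (simp add: monom_power)
    also have "(\<Prod>i | p i \<noteq> i. ?M $ i $ p i) = (\<Prod>i | p i \<noteq> i. [:- A $ i $ p i:])"
      by (rule prod.cong) (auto simp: mat_def)
    also have "\<dots> = [:\<Prod>i | p i \<noteq> i. - A $ i $ p i:]"
      by (rule prod_to_poly)
    finally show ?thesis
      by (simp add: smult_monom mult.commute)
  qed
  let ?T = "{p. p permutes (UNIV :: 'n set) \<and> card {i. p i \<noteq> i} = 2}"
  let ?g = "\<lambda>p. of_int (sign p) * (\<Prod>i | p i \<noteq> i. - A $ i $ p i)"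
  have moved: "{i. Transposition.transpose a b i \<noteq> i} = {a, b}" if "a \<noteq> b" for a b :: 'n
    using that by (auto simp: Transposition.transpose_def)
  have irr: "a \<noteq> b" if "(a, b) \<in> P" for a b
    using that P(1) by (auto dest: asymD)
  have card: "card {i. p i = i} = n \<longleftrightarrow> card {i. p i \<noteq> i} = 2" for p :: "'n \<Rightarrow> 'n"
  proof -
    have "card {i. p i = i} + card {i. p i \<noteq> i} = card ({i. p i = i} \<union> {i. p i \<noteq> i})"
      by (rule card_Un_disjoint[symmetric]) auto
    also have "{i. p i = i} \<union> {i. p i \<noteq> i} = UNIV" by auto
    finally show ?thesis using n by linarith
  qed
  have "coeff (det ?M) n
    = (\<Sum>p | p permutes (UNIV :: 'n set). coeff (of_int (sign p) * (\<Prod>i\<in>UNIV. ?M $ i $ p i)) n)"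
    by (simp only: det_def coeff_sum)
  also have "\<dots> = (\<Sum>p | p permutes (UNIV :: 'n set). if card {i. p i \<noteq> i} = 2 then ?g p else 0)"
    by (rule sum.cong[OF refl]) (simp only: prod of_int_poly coeff_pCons_0, simp add: card smult_monom)
  also have "\<dots> = sum ?g ?T"
    by (simp add: sum.If_cases finite_permutations Int_def)
  also have "\<dots> = (\<Sum>(a, b)\<in>P. ?g (Transposition.transpose a b))"
    unfolding case_prod_unfold
  proof (rule sum.reindex_bij_betw[symmetric, where h = "\<lambda>x. Transposition.transpose (fst x) (snd x)", unfolded o_def])
    have "inj_on (\<lambda>x. Transposition.transpose (fst x) (snd x)) P"
    proof (rule inj_onI)
      fix x y assume xy: "x \<in> P" "y \<in> P" and eq: "Transposition.transpose (fst x) (snd x) = Transposition.transpose (fst y) (snd y)"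
      \<comment> \<open>A transposition determines its pair as the set of moved points; asymmetry
        then fixes the order.\<close>
      have "{fst x, snd x} = {fst y, snd y}"
        using xy irr by (metis eq moved prod.collapse)
      with xy P(1) show "x = y"
        by (cases x; cases y) (auto simp: doubleton_eq_iff dest: asymD)
    qed
    moreover have "(\<lambda>x. Transposition.transpose (fst x) (snd x)) ` P = ?T"
    proof (intro equalityI subsetI)
      fix p assume p: "p \<in> ?T"
      then obtain a b where ab: "{i. p i \<noteq> i} = {a, b}" "a \<noteq> b"
        by (auto simp: card_2_iff)
      then have "p a \<noteq> a" "p b \<noteq> b" "\<And>i. i \<noteq> a \<Longrightarrow> i \<noteq> b \<Longrightarrow> p i = i" by blast+
      moreover have "inj p" using p by (auto intro: permutes_inj)
      \<comment> \<open>If \<open>p a\<close> were a point c outside {a, b}, then c would be fixed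
        and \<open>p a = p c\<close>, against injectivity.\<close>
      ultimately have "p a = b" "p b = a" by (metis injD)+
      with ab have "p = Transposition.transpose a b" by (auto simp: Transposition.transpose_def fun_eq_iff)
      then have "p = Transposition.transpose b a" "p = Transposition.transpose a b" by (simp_all add: transpose_commute)
      with P(2) \<open>a \<noteq> b\<close> show "p \<in> (\<lambda>x. Transposition.transpose (fst x) (snd x)) ` P"
        by (force simp: total_on_def)
    qed (use irr moved in \<open>force simp: permutes_swap_id\<close>)
    ultimately show "bij_betw (\<lambda>x. Transposition.transpose (fst x) (snd x)) P ?T"
      by (simp add: bij_betw_def)
  qed
  also have "\<dots> = (\<Sum>(a, b)\<in>P. - (A $ a $ b * A $ b $ a))"
    by (rule sum.cong[OF refl]) (use irr in \<open>auto simp: moved sign_swap_id\<close>)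
  finally show ?thesis by (simp add: sum_negf case_prod_unfold)
qed

section \<open>Squares of Kaehler forms, evaluated on vectors\<close>

text \<open>A shuffle divides the positions of \<open>vs\<close> between the two factors, so at
  least one factor gets a list of the wrong length.\<close>

lemma wedge_eq_0:
  assumes f: "\<And>vs. length vs \<noteq> p \<Longrightarrow> f vs = 0" and g: "\<And>vs. length vs \<noteq> q \<Longrightarrow> g vs = 0"
    and vs: "length vs \<noteq> p + q"
  shows "wedge f g vs = 0"
  unfolding wedge_def
proof (rule sum.neutral, rule ballI)
  fix S assume "S \<in> Pow {..<length vs}"
  have "length (nths vs S) + length (nths vs (- S)) = length vs"
    by (induction vs arbitrary: S) (auto simp: nths_Cons Collect_neg_eq)
  with vs have "length (nths vs S) \<noteq> p \<or> length (nths vs (- S)) \<noteq> q" by auto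
  with f g show "shuffle_sign S * f (nths vs S) * g (nths vs (- S)) = 0" by auto
qed

lemma kaehler_form_eq_0: "length vs \<noteq> 2 \<Longrightarrow> apply_form (kaehler_form J) vs = 0"
  by transfer (auto split: list.split)

text \<open>Complementary (2,2)-shuffles have equal signs and equal products, so the six shuffles
  reduce to three pairings, each counted twice.\<close>

lemma kaehler_form_squared_apply:
  assumes "orthogonal_complex_structure J"
  shows "apply_form (kaehler_form J ^ 2) [x, y, z, w]
    = 2 * ((x \<bullet> J y) * (z \<bullet> J w) - (x \<bullet> J z) * (y \<bullet> J w) + (x \<bullet> J w) * (y \<bullet> J z))"
  by (simp add: power2_eq_square times_even_form.rep_eq wedge_Cons wedge_linear contract_def
      grade_def kaehler_form_eq_0 kaehler_form_apply[OF assms])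

lemma kaehler_form_squared_eq_0:
  "length vs \<noteq> 4 \<Longrightarrow> apply_form (kaehler_form J ^ 2) vs = 0"
  using wedge_eq_0[of 2 "apply_form (kaehler_form J)" 2 "apply_form (kaehler_form J)" vs]
  by (simp add: power2_eq_square times_even_form.rep_eq kaehler_form_eq_0)

lemma apply_form_sum: "apply_form (sum f A) vs = (\<Sum>a\<in>A. apply_form (f a) vs)"
  by (induction A rule: infinite_finite_induct)
    (simp_all add: zero_even_form.rep_eq plus_even_form.rep_eq)

section \<open>Quaternion identities\<close>

text \<open>Both sides equal \<open>\<langle>b\<^sup>* a, d\<^sup>* c\<rangle>\<close>.\<close>

lemma qmult_fierz:
  "(a \<bullet> b) * (c \<bullet> d) + (a \<bullet> qmult b q_i) * (c \<bullet> qmult d q_i)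
     + (a \<bullet> qmult b q_j) * (c \<bullet> qmult d q_j) + (a \<bullet> qmult b q_k) * (c \<bullet> qmult d q_k)
   = (a \<bullet> c) * (b \<bullet> d) + (qmult q_i a \<bullet> c) * (qmult q_i b \<bullet> d)
     + (qmult q_j a \<bullet> c) * (qmult q_j b \<bullet> d) + (qmult q_k a \<bullet> c) * (qmult q_k b \<bullet> d)"
  by (cases a; cases b; cases c; cases d) (simp add: q_defs algebra_simps)

lemma qmult_skew:
  assumes "u \<in> {q_i, q_j, q_k}"
  shows "x \<bullet> qmult y u = - (y \<bullet> qmult x u)"
  using assms by (cases x; cases y; elim insertE emptyE; simp add: q_defs algebra_simps)

lemma J_struct_simps:
  "J_struct 1 2 (x, y) = (qmult x q_i, - qmult y q_i)"
  "J_struct 1 3 (x, y) = (qmult x q_j, - qmult y q_j)"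
  "J_struct 1 4 (x, y) = (qmult x q_k, - qmult y q_k)"
  "J_struct 1 5 (x, y) = (- y, x)"
  "J_struct 2 3 (x, y) = (qmult x q_k, qmult y q_k)"
  "J_struct 2 4 (x, y) = (- qmult x q_j, - qmult y q_j)"
  "J_struct 2 5 (x, y) = (qmult y q_i, qmult x q_i)"
  "J_struct 3 4 (x, y) = (qmult x q_i, qmult y q_i)"
  "J_struct 3 5 (x, y) = (qmult y q_j, qmult x q_j)"
  "J_struct 4 5 (x, y) = (qmult y q_k, qmult x q_k)"
  by (cases x; cases y; simp add: J_struct_def involution_simps q_defs)+

section \<open>Computation of \<open>tau2 theta\<close>\<close>

text \<open>Although \<open>5 = 0\<close> in the index type, \<open>5\<close> counts as the largest
  index here.\<close>

definition index_pairs :: "5 rel" where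
  "index_pairs = {(1,2), (1,3), (1,4), (1,5), (2,3), (2,4), (2,5), (3,4), (3,5), (4,5)}"

lemma asym_index_pairs: "asym index_pairs"
  unfolding index_pairs_def by (rule asymI) auto

lemma total_index_pairs: "total index_pairs"
proof -
  have "a = b \<or> (a, b) \<in> index_pairs \<or> (b, a) \<in> index_pairs" for a b
    unfolding index_pairs_def using exhaust_5[of a] exhaust_5[of b] by auto
  then show ?thesis by (auto simp: total_on_def)
qed

text \<open>The power 3 leaves two moved indices out of five, and skewness of \<open>theta\<close>
  turns the products of opposite entries into squares.\<close>

lemma tau2_theta: "tau2 theta = (\<Sum>(a, b)\<in>index_pairs. kaehler_form (J_struct a b) ^ 2)"
proof -
  have diag: "theta $ i $ i = 0" for i by (simp add: theta_def)
  have skew: "theta $ b $ a = - (theta $ a $ b)" for a b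
    using arg_cong[OF theta_skew, of "\<lambda>A. A $ a $ b"]
    by (simp add: Finite_Cartesian_Product.transpose_def)
  have "tau2 theta = - (\<Sum>(a, b)\<in>index_pairs. theta $ a $ b * theta $ b $ a)"
    unfolding tau2_def
    by (rule coeff_det_transpositions[OF diag asym_index_pairs total_index_pairs]) simp
  also have "\<dots> = (\<Sum>(a, b)\<in>index_pairs. (theta $ a $ b) ^ 2)"
    unfolding sum_negf[symmetric] case_prod_unfold
    by (rule sum.cong[OF refl]) (simp add: power2_eq_square skew[of "snd _" "fst _"])
  also have "\<dots> = (\<Sum>(a, b)\<in>index_pairs. kaehler_form (J_struct a b) ^ 2)"
    by (rule sum.cong[OF refl]) (use asym_index_pairs in \<open>auto simp: theta_def dest: asymD\<close>)
  finally show ?thesis .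
qed

lemma sum_J_struct:
  "(\<Sum>(a, b)\<in>index_pairs. (x \<bullet> J_struct a b y) * (z \<bullet> J_struct a b w))
   = (x \<bullet> z) * (y \<bullet> w) - (y \<bullet> z) * (x \<bullet> w)
     + (\<Sum>u\<in>{q_i, q_j, q_k}. (Ldiag u x \<bullet> z) * (Ldiag u y \<bullet> w)
       - (Ldiag u y \<bullet> z) * (Ldiag u x \<bullet> w))"
proof -
  obtain x1 x2 where x: "x = (x1, x2)" by (cases x)
  obtain y1 y2 where y: "y = (y1, y2)" by (cases y)
  obtain z1 z2 where z: "z = (z1, z2)" by (cases z)
  obtain w1 w2 where w: "w = (w1, w2)" by (cases w)
  define F where "F a b c d = (a \<bullet> b) * (c \<bullet> d) + (a \<bullet> qmult b q_i) * (c \<bullet> qmult d q_i)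
     + (a \<bullet> qmult b q_j) * (c \<bullet> qmult d q_j) + (a \<bullet> qmult b q_k) * (c \<bullet> qmult d q_k)" for a b c d
  have skew: "y \<bullet> qmult x q_i = - (x \<bullet> qmult y q_i)" "y \<bullet> qmult x q_j = - (x \<bullet> qmult y q_j)"
    "y \<bullet> qmult x q_k = - (x \<bullet> qmult y q_k)" for x y
    by (rule qmult_skew; simp)+
  \<comment> \<open>Instances at fixed vectors orient the skewness laws, which would loop as general
    rewrite rules.\<close>
  note skews = skew[of y1 x1] skew[of y2 x1] skew[of y2 x2] skew[of w2 z1]
    inner_commute[of y1 x1] inner_commute[of y2 x1] inner_commute[of y2 x2] inner_commute[of w2 z1]
  have distinct: "q_i \<noteq> q_j" "q_i \<noteq> q_k" "q_j \<noteq> q_k" by (simp_all add: q_defs)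
  \<comment> \<open>\<open>F\<close> is one side of \<open>qmult_fierz\<close>. The structures 12
    and 34, 13 and 24, 14 and 23 act by the same unit up to signs on the summands, so products
    mixing the summands cancel; the rest double, as do the unit terms in the differences of
    \<open>F\<close>, whose inner-product terms cancel. The four structures with index 5 give the
    last four values of \<open>F\<close>.\<close>
  have "(\<Sum>(a, b)\<in>index_pairs. (x \<bullet> J_struct a b y) * (z \<bullet> J_struct a b w))
    = F x1 y1 z1 w1 - F y1 x1 z1 w1 + (F x2 y2 z2 w2 - F y2 x2 z2 w2)
      + F x2 y1 z2 w1 - F y2 x1 z2 w1 - F x2 y1 w2 z1 + F x1 y2 z1 w2"
    unfolding F_def skews
    by (simp add: index_pairs_def J_struct_simps x y z w algebra_simps del: qmult.simps)
  also have "\<dots> = (x \<bullet> z) * (y \<bullet> w) - (y \<bullet> z) * (x \<bullet> w)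
     + (\<Sum>u\<in>{q_i, q_j, q_k}. (Ldiag u x \<bullet> z) * (Ldiag u y \<bullet> w)
       - (Ldiag u y \<bullet> z) * (Ldiag u x \<bullet> w))"
    unfolding F_def qmult_fierz
    by (simp add: distinct Ldiag_def Lmul_def x y z w algebra_simps del: qmult.simps)
  finally show ?thesis .
qed

lemma tau2_theta_eq_Omega_L: "tau2 theta = - (2 *\<^sub>R Omega_L)"
proof -
  have distinct: "q_i \<noteq> q_j" "q_i \<noteq> q_k" "q_j \<noteq> q_k" by (simp_all add: q_defs)
  have Omega: "Omega_L = (\<Sum>u\<in>{q_i, q_j, q_k}. kaehler_form (Ldiag u) ^ 2)"
    by (simp add: Omega_L_def omega_L_def distinct)
  have "apply_form (tau2 theta) vs = - 2 * apply_form Omega_L vs" for vs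
  \<comment> \<open>Both sides are homogeneous of degree 4, so only lists of four vectors
    matter.\<close>
  proof (cases "length vs = 4")
    case False
    then show ?thesis
      by (simp add: tau2_theta Omega apply_form_sum case_prod_unfold kaehler_form_squared_eq_0)
  next
    case True
    then obtain x y z w where vs: "vs = [x, y, z, w]"
      by (auto simp: length_Suc_conv numeral_eq_Suc)
    have irrefl: "a \<noteq> b" if "(a, b) \<in> index_pairs" for a b
      using that asym_index_pairs by (auto dest: asymD)
    let ?S = "\<lambda>x y z w. \<Sum>(a, b)\<in>index_pairs. (x \<bullet> J_struct a b y) * (z \<bullet> J_struct a b w)"
    have "apply_form (tau2 theta) vs = (\<Sum>(a, b)\<in>index_pairs.
        2 * ((x \<bullet> J_struct a b y) * (z \<bullet> J_struct a b w) - (x \<bullet> J_struct a b z) * (y \<bullet> J_struct a b w)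
          + (x \<bullet> J_struct a b w) * (y \<bullet> J_struct a b z)))"
      unfolding tau2_theta apply_form_sum vs
      by (rule sum.cong[OF refl])
        (auto simp: irrefl kaehler_form_squared_apply[OF orthogonal_complex_structure_J])
    also have "\<dots> = 2 * (?S x y z w - ?S x z y w + ?S x w y z)"
      by (simp add: case_prod_unfold sum_distrib_left sum.distrib sum_subtractf)
    also have "\<dots> = - 2 * (\<Sum>u\<in>{q_i, q_j, q_k}. 2 * ((x \<bullet> Ldiag u y) * (z \<bullet> Ldiag u w)
        - (x \<bullet> Ldiag u z) * (y \<bullet> Ldiag u w) + (x \<bullet> Ldiag u w) * (y \<bullet> Ldiag u z)))"
    proof -
      have skew: "Ldiag u x \<bullet> y = - (x \<bullet> Ldiag u y)" "x \<bullet> Ldiag u y = - (y \<bullet> Ldiag u x)"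
        if "u \<in> {q_i, q_j, q_k}" for u x y
        using orthogonal_complex_structure_skew[OF
            orthogonal_complex_structure_Rdiag_Ldiag(2)[OF that], of x y]
        by (simp_all add: inner_commute)
      let ?t = "\<lambda>u x y z w. (Ldiag u x \<bullet> z) * (Ldiag u y \<bullet> w) - (Ldiag u y \<bullet> z) * (Ldiag u x \<bullet> w)"
      \<comment> \<open>By skewness each pairing occurs twice, with the sign opposite to the one in
        the square of the Kaehler form.\<close>
      have "?t u x y z w - ?t u x z y w + ?t u x w y z
        = - 2 * ((x \<bullet> Ldiag u y) * (z \<bullet> Ldiag u w)
        - (x \<bullet> Ldiag u z) * (y \<bullet> Ldiag u w) + (x \<bullet> Ldiag u w) * (y \<bullet> Ldiag u z))"
        if u: "u \<in> {q_i, q_j, q_k}" for u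
        unfolding skew(1)[OF u] skew(2)[OF u, of z y] skew(2)[OF u, of w y] skew(2)[OF u, of w z]
        by (simp add: algebra_simps)
      then have "(\<Sum>u\<in>{q_i, q_j, q_k}. ?t u x y z w - ?t u x z y w + ?t u x w y z)
        = (\<Sum>u\<in>{q_i, q_j, q_k}. - 2 * ((x \<bullet> Ldiag u y) * (z \<bullet> Ldiag u w)
        - (x \<bullet> Ldiag u z) * (y \<bullet> Ldiag u w) + (x \<bullet> Ldiag u w) * (y \<bullet> Ldiag u z)))"
        by (rule sum.cong[OF refl])
      then show ?thesis
        \<comment> \<open>The inner-product terms of \<open>sum_J_struct\<close> cancel in the
          alternating sum by symmetry.\<close>
        unfolding sum_J_struct sum.distrib sum_subtractf sum_distrib_left[symmetric]
        by (simp add: inner_commute)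
    qed
    also have "\<dots> = - 2 * apply_form Omega_L vs"
      unfolding Omega apply_form_sum vs
      by (intro arg_cong[where f = "\<lambda>s. - 2 * s"] sum.cong[OF refl])
        (simp add: kaehler_form_squared_apply orthogonal_complex_structure_Rdiag_Ldiag)
    finally show ?thesis .
  qed
  then show ?thesis
    by (auto simp: apply_form_inject[symmetric] fun_eq_iff uminus_even_form.rep_eq
        scaleR_even_form.rep_eq)
qed

theorem proposition3p4:
  shows "Omega_L = - ((1 / 2) *\<^sub>R tau2 theta) \<and>
         omega_R q_i = theta $ 3 $ 4 \<and>
         omega_R q_j = - (theta $ 2 $ 4) \<and>
         omega_R q_k = theta $ 2 $ 3"
proof (intro conjI)
  show "Omega_L = - ((1 / 2) *\<^sub>R tau2 theta)"
    by (simp add: tau2_theta_eq_Omega_L)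
  have R: "Rdiag q_i = J_struct 3 4" "Rdiag q_j = J_struct 4 2" "Rdiag q_k = J_struct 2 3"
    \<comment> \<open>\<open>J_struct 2 4\<close> is minus right multiplication by j; this is the
      source of the sign in \<open>omega_R q_j\<close>.\<close>
    by (auto simp: fun_eq_iff Rdiag_def Rmul_def J_struct_simps J_struct_swap[of 2 4])
  have "theta $ 4 $ 2 = - (theta $ 2 $ 4)"
    using arg_cong[OF theta_skew, of "\<lambda>A. A $ 2 $ 4"]
    by (simp add: Finite_Cartesian_Product.transpose_def)
  with R show "omega_R q_i = theta $ 3 $ 4" "omega_R q_j = - (theta $ 2 $ 4)"
    "omega_R q_k = theta $ 2 $ 3"
    by (simp_all add: omega_R_def theta_def)
qed

end
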